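(* Let $d\ge 1$ be an integer and let $g$ be a piecewise-algebraic function on $[0,1]$ of combinatorial complexity $\sigma(g)=d$. Then $g$ is uniquely determined by its moments up to order $\kappa(d)=2d(\eta(d,d)+1)$ among piecewise-algebraic functions of combinatorial complexity at most $d$. That is, if $h$ is a piecewise-algebraic function on $[0,1]$ with $\sigma(h)\le d$ and $$\int_0^1 x^j g(x)\,dx=\int_0^1 x^j h(x)\,dx,\qquad j=0,1,\dots,\kappa(d),$$ then $g=h$ (as piecewise-algebraic functions, i.e. up to values at finitely many points).
   Context: A continuous real function $g$ on a closed interval $\Delta\subset[0,1]$ of positive length is called algebraic if $y=g(x)$ satisfies on $\Delta$ an equation $a_n(x)y^n+a_{n-1}(x)y^{n-1}+\dots+a_1(x)y+a_0(x)=0$ with $n\ge 1$, where $a_0,\dots,a_n$ are real polynomials in $x$ of degree at most $m$, not all identically zero. The degree $\deg g$ is $m+n$ (the minimal such value over all such equations for $g$). $\eta:\mathbb{N}\times\mathbb{N}\to\mathbb{N}$ denotes a fixed function such that, whenever $g_1,g_2$ are algebraic functions on a common interval of degrees at most $d_1$ and $d_2$ respectively, $g_1+g_2$ is algebraic of degree at most $\eta(d_1,d_2)$ (such a function exists). A function $g$ on $[0,1]$ is piecewise-algebraic if there are a partition $0=x_0<x_1<\dots<x_r<x_{r+1}=1$ and algebraic functions $g_q$ on $\Delta_q=[x_q,x_{q+1}]$, of degree $d_q$, such that $g=g_q$ on the interior of $\Delta_q$, $q=0,\dots,r$. Values at the partition points are immaterial: functions agreeing outside a finite set are identified. The combinatorial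 complexity is $\sigma(g)=\sum_{q=0}^r d_q+r$ (the minimal such value over all representations of $g$ of this kind). *)

theory Defs
  imports "HOL-Analysis.Analysis" "HOL-Computational_Algebra.Polynomial"
begin

text \<open>The interval \<open>\<Delta>\<close> is \<open>{a..b}\<close>; values of \<open>g\<close> outside it are irrelevant.\<close>

definition algebraic_equation :: "real \<Rightarrow> real \<Rightarrow> (real \<Rightarrow> real) \<Rightarrow> nat \<Rightarrow> nat \<Rightarrow> bool" where
  "algebraic_equation a b g m n \<longleftrightarrow>
     n \<ge> 1 \<and>
     (\<exists>c :: nat \<Rightarrow> real poly.
        (\<forall>i\<le>n. degree (c i) \<le> m) \<and>
        (\<exists>i\<le>n. c i \<noteq> 0) \<and>
        (\<forall>x\<in>{a..b}. (\<Sum>i\<le>n. poly (c i) x * g x ^ i) = 0))"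

definition algebraic_on :: "real \<Rightarrow> real \<Rightarrow> (real \<Rightarrow> real) \<Rightarrow> bool" where
  "algebraic_on a b g \<longleftrightarrow>
     a < b \<and> {a..b} \<subseteq> {0..1} \<and> continuous_on {a..b} g \<and>
     (\<exists>m n. algebraic_equation a b g m n)"

definition algebraic_degree :: "real \<Rightarrow> real \<Rightarrow> (real \<Rightarrow> real) \<Rightarrow> nat" where
  "algebraic_degree a b g = (LEAST k. \<exists>m n. k = m + n \<and> algebraic_equation a b g m n)"

definition sum_degree_bound :: "(nat \<Rightarrow> nat \<Rightarrow> nat) \<Rightarrow> bool" where
  "sum_degree_bound \<eta> \<longleftrightarrow>
     (\<forall>a b g\<^sub>1 g\<^sub>2 d\<^sub>1 d\<^sub>2.
        algebraic_on a b g\<^sub>1 \<and> algebraic_degree a b g\<^sub>1 \<le> d\<^sub>1 \<and>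
        algebraic_on a b g\<^sub>2 \<and> algebraic_degree a b g\<^sub>2 \<le> d\<^sub>2 \<longrightarrow>
        algebraic_on a b (\<lambda>x. g\<^sub>1 x + g\<^sub>2 x) \<and>
        algebraic_degree a b (\<lambda>x. g\<^sub>1 x + g\<^sub>2 x) \<le> \<eta> d\<^sub>1 d\<^sub>2)"

definition piecewise_representation ::
  "(real \<Rightarrow> real) \<Rightarrow> nat \<Rightarrow> (nat \<Rightarrow> real) \<Rightarrow> (nat \<Rightarrow> real \<Rightarrow> real) \<Rightarrow> bool" where
  "piecewise_representation g r x p \<longleftrightarrow>
     x 0 = 0 \<and> x (Suc r) = 1 \<and> (\<forall>q\<le>r. x q < x (Suc q)) \<and>
     (\<forall>q\<le>r. algebraic_on (x q) (x (Suc q)) (p q) \<and>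
             (\<forall>t\<in>{x q<..<x (Suc q)}. g t = p q t))"

definition piecewise_algebraic :: "(real \<Rightarrow> real) \<Rightarrow> bool" where
  "piecewise_algebraic g \<longleftrightarrow> (\<exists>r x p. piecewise_representation g r x p)"

definition representation_complexity ::
  "nat \<Rightarrow> (nat \<Rightarrow> real) \<Rightarrow> (nat \<Rightarrow> real \<Rightarrow> real) \<Rightarrow> nat" where
  "representation_complexity r x p = (\<Sum>q\<le>r. algebraic_degree (x q) (x (Suc q)) (p q)) + r"

definition eq_up_to_finite :: "(real \<Rightarrow> real) \<Rightarrow> (real \<Rightarrow> real) \<Rightarrow> bool" where
  "eq_up_to_finite g h \<longleftrightarrow> finite {t\<in>{0..1}. g t \<noteq> h t}"

text \<open>
  Functions agreeing off a finite set are identified, so the minimum ranges over the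
  representations of every function in the class of \<open>g\<close>; otherwise changing \<open>g\<close> at one
  point inside a piece would force an extra partition point and raise the complexity.
  Both \<open>LEAST\<close> operators are meaningful only for (piecewise-)algebraic functions.
\<close>

definition combinatorial_complexity :: "(real \<Rightarrow> real) \<Rightarrow> nat" where
  "combinatorial_complexity g =
     (LEAST s. \<exists>g' r x p. eq_up_to_finite g g' \<and> piecewise_representation g' r x p \<and>
                          s = representation_complexity r x p)"

end

theory Submission
  imports Defs
begin

text \<open>
  Off finitely many points \<open>f = g - h\<close> is algebraic of degree at most \<open>\<eta> d d\<close> on each of at
  most \<open>2 * d\<close> intervals. Cancelling the largest possible power of \<open>y\<close> from the equation of an
  algebraic function makes the lowest coefficient a nonzero polynomial, and the function can change
  sign only at the roots of that coefficient. So \<open>f\<close> has at most \<open>2 * d * (\<eta> d d + 1)\<close> sign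
  changes, and some nonzero polynomial \<open>P\<close> of at most this degree satisfies \<open>P * f \<ge> 0\<close>.
  The moment equations give \<open>\<integral> P * f = 0\<close>, which forces \<open>f = 0\<close> by piecewise continuity.
\<close>

section \<open>Polynomials that reproduce a finite sign pattern\<close>

lemma mult_pos_of_nonvanishing:
  fixes f :: "real \<Rightarrow> real"
  assumes "s \<le> t" and cont: "continuous_on {s..t} f" and nz: "\<And>x. x \<in> {s..t} \<Longrightarrow> f x \<noteq> 0"
  shows "0 < f s * f t"
proof (rule ccontr)
  assume "\<not> 0 < f s * f t"
  with nz[of s] nz[of t] \<open>s \<le> t\<close> have "f s < 0 \<and> 0 < f t \<or> 0 < f s \<and> f t < 0"
    by (auto simp: zero_less_mult_iff)
  then have "\<exists>x\<in>{s..t}. f x = 0"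
    using IVT'[of f s 0 t] IVT2'[of f t 0 s] assms by fastforce
  with nz show False by blast
qed

text \<open>Induction that adds the points of \<open>T\<close> from left to right: the polynomial
  found so far is kept if it still matches \<open>f\<close> beyond the new point \<open>t\<close>,
  and is multiplied by \<open>t - x\<close> otherwise. Confining the roots to \<open>T\<close> fixes
  the sign of \<open>P\<close> beyond the old points, and later allows \<open>P\<close> to be
  cancelled off \<open>T\<close>.\<close>

lemma exists_sign_matching_poly:
  fixes T A :: "real set" and f :: "real \<Rightarrow> real"
  assumes "finite T"
    and "\<And>x y. \<lbrakk>x \<in> A; y \<in> A; x < y; {x..y} \<inter> T = {}\<rbrakk> \<Longrightarrow> 0 \<le> f x * f y"
  shows "\<exists>P. degree P \<le> card T \<and> {x. poly P x = 0} \<subseteq> T \<and>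
             (\<forall>x\<in>A - T. 0 \<le> poly P x * f x)"
  using assms
proof (induction T arbitrary: f rule: finite_linorder_max_induct)
  case empty
  show ?case
  proof (cases "\<exists>z\<in>A. f z < 0")
    case True
    then obtain z where z: "z \<in> A" "f z < 0" by blast
    have "f x \<le> 0" if "x \<in> A" for x
      using empty[of x z] empty[of z x] that z
      by (cases x z rule: linorder_cases) (auto simp: zero_le_mult_iff)
    then show ?thesis by (intro exI[of _ "[:-1:]"]) auto
  next
    case False
    then show ?thesis by (intro exI[of _ 1]) (auto simp: not_less)
  qed
next
  case (insert t T)
  \<comment> \<open>The induction hypothesis requires sign constancy on every interval missing
    \<open>T\<close>, but \<open>f\<close> may change sign at \<open>t\<close>. Zeroing
    \<open>f\<close> from \<open>t\<close> on makes every product that involves such a point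
    trivial.\<close>
  define f' where "f' x = (if x < t then f x else 0)" for x
  have "\<exists>P. degree P \<le> card T \<and> {x. poly P x = 0} \<subseteq> T \<and>
          (\<forall>x\<in>A - T. 0 \<le> poly P x * f' x)"
  proof (rule insert.IH)
    fix x y assume "x \<in> A" "y \<in> A" "x < y" "{x..y} \<inter> T = {}"
    then show "0 \<le> f' x * f' y"
      using insert.prems[of x y] by (auto simp: f'_def)
  qed
  then obtain P where P: "degree P \<le> card T" "{x. poly P x = 0} \<subseteq> T"
    "\<And>x. x \<in> A - T \<Longrightarrow> 0 \<le> poly P x * f' x" by blast
  have left: "0 \<le> poly P x * f x" if "x \<in> A - T" "x < t" for x
    using P(3)[of x] that by (simp add: f'_def)
  have card: "card (insert t T) = Suc (card T)"
    using insert.hyps by (intro card_insert_disjoint) blast+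
  have nz: "poly P x \<noteq> 0" if "t < x" for x
    using P(2) insert.hyps that by force
  \<comment> \<open>Every point of \<open>T\<close> lies below \<open>t\<close>, so beyond
    \<open>t\<close> neither \<open>P\<close> nor \<open>f\<close> changes sign. A single negative
    value of the product there settles its sign on the whole right side.\<close>
  have same: "0 \<le> (poly P x * f x) * (poly P z * f z)" if "x \<in> A" "z \<in> A" "t < x" "x < z" for x z
  proof -
    have "0 < poly P x * poly P z"
      using that nz by (intro mult_pos_of_nonvanishing continuous_intros) auto
    moreover have "0 \<le> f x * f z"
      using insert.hyps that by (intro insert.prems) force+
    ultimately have "0 \<le> (poly P x * poly P z) * (f x * f z)" by simp
    then show ?thesis by (simp add: mult_ac)
  qed
  show ?case
  proof (cases "\<exists>z\<in>A. t < z \<and> poly P z * f z < 0")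
    case True
    then obtain z where z: "z \<in> A" "t < z" "poly P z * f z < 0" by blast
    have right: "poly P x * f x \<le> 0" if "x \<in> A" "t < x" for x
    proof -
      have "0 \<le> (poly P x * f x) * (poly P z * f z)"
        using same[of x z] same[of z x] that z
        by (cases x z rule: linorder_cases) (simp_all only: mult.commute zero_le_square)
      then show ?thesis using z(3) by (meson mult_pos_neg not_le)
    qed
    \<comment> \<open>The factor \<open>t - x\<close> is positive left of \<open>t\<close>, where
      the sign was already right, and negative beyond it, where the sign was wrong.\<close>
    define Q where "Q = [:t, -1:] * P"
    have pQ: "poly Q x = (t - x) * poly P x" for x by (simp add: Q_def algebra_simps)
    have "degree Q \<le> card (insert t T)"
      using degree_mult_le[of "[:t, -1:]" P] P(1) card by (simp add: Q_def)
    moreover have "{x. poly Q x = 0} \<subseteq> insert t T" using P(2) by (auto simp: pQ)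
    moreover have "0 \<le> poly Q x * f x" if x: "x \<in> A - insert t T" for x
    proof -
      have "0 \<le> (t - x) * (poly P x * f x)"
        using left[of x] right[of x] x by (cases "x < t") (auto simp: zero_le_mult_iff)
      then show ?thesis by (simp add: pQ mult_ac)
    qed
    ultimately show ?thesis by blast
  next
    case False
    have "0 \<le> poly P x * f x" if "x \<in> A - insert t T" for x
      using left[of x] False that by (cases "x < t") (auto simp: not_less)
    then show ?thesis using P card by (intro exI[of _ P]) auto
  qed
qed

section \<open>Algebraic functions: degree and sign changes\<close>

lemma algebraic_equation_degree:
  assumes "algebraic_on a b g"
  obtains m n where "algebraic_degree a b g = m + n" "algebraic_equation a b g m n"
proof -
  have "\<exists>k m n. k = m + n \<and> algebraic_equation a b g m n"
    using assms by (auto simp: algebraic_on_def)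
  from LeastI_ex[OF this] show ?thesis
    using that unfolding algebraic_degree_def by blast
qed

lemma algebraic_degree_le:
  "algebraic_equation a b g m n \<Longrightarrow> algebraic_degree a b g \<le> m + n"
  unfolding algebraic_degree_def by (rule Least_le) blast

text \<open>Comes from the clause \<open>n \<ge> 1\<close>. It makes every piece cost at least 1 in
  the complexity, which bounds the number of pieces.\<close>

lemma algebraic_degree_pos: "algebraic_on a b g \<Longrightarrow> 1 \<le> algebraic_degree a b g"
  by (erule algebraic_equation_degree) (auto simp: algebraic_equation_def)

lemma algebraic_subinterval:
  assumes "algebraic_on a b g" "a \<le> a'" "a' < b'" "b' \<le> b"
  shows "algebraic_on a' b' g" "algebraic_degree a' b' g \<le> algebraic_degree a b g"
proof -
  have sub: "{a'..b'} \<subseteq> {a..b}" using assms by auto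
  then have eq: "algebraic_equation a' b' g m n" if "algebraic_equation a b g m n" for m n
    using that unfolding algebraic_equation_def by blast
  show "algebraic_on a' b' g"
    using assms sub eq unfolding algebraic_on_def
    by (meson continuous_on_subset dual_order.trans)
  show "algebraic_degree a' b' g \<le> algebraic_degree a b g"
    using algebraic_equation_degree[OF assms(1)] eq algebraic_degree_le by metis
qed

text \<open>The factors \<open>(-1) ^ i\<close> on the coefficients absorb the sign with the same
  \<open>m\<close> and \<open>n\<close>. This reduces differences to sums, the only operation that
  \<open>sum_degree_bound\<close> covers.\<close>

lemma algebraic_uminus:
  assumes "algebraic_on a b g"
  shows "algebraic_on a b (\<lambda>x. - g x)"
    and "algebraic_degree a b (\<lambda>x. - g x) \<le> algebraic_degree a b g"
proof -
  have eq: "algebraic_equation a b (\<lambda>x. - g x) m n" if eqn: "algebraic_equation a b g m n" for m n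
  proof -
    obtain c where c: "n \<ge> 1" "\<forall>i\<le>n. degree (c i) \<le> m" "\<exists>i\<le>n. c i \<noteq> 0"
      "\<forall>x\<in>{a..b}. (\<Sum>i\<le>n. poly (c i) x * g x ^ i) = 0"
      using eqn unfolding algebraic_equation_def by blast
    have *: "poly (smult ((-1) ^ i) (c i)) x * (- g x) ^ i = poly (c i) x * g x ^ i" for i x
      by (cases "even i") auto
    have "(\<Sum>i\<le>n. poly (smult ((-1) ^ i) (c i)) x * (- g x) ^ i) = 0" if "x \<in> {a..b}" for x
      using c(4) that by (simp only: *)
    with c(1-3) show ?thesis unfolding algebraic_equation_def
      by (intro conjI exI[of _ "\<lambda>i. smult ((-1) ^ i) (c i)"]) (auto simp del: poly_smult)
  qed
  show "algebraic_on a b (\<lambda>x. - g x)"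
    using assms eq unfolding algebraic_on_def by (blast intro: continuous_on_minus)
  show "algebraic_degree a b (\<lambda>x. - g x) \<le> algebraic_degree a b g"
    using algebraic_equation_degree[OF assms] eq algebraic_degree_le by metis
qed

lemma algebraic_diff:
  assumes "sum_degree_bound \<eta>"
    and "algebraic_on a b g" "algebraic_degree a b g \<le> d\<^sub>1"
    and "algebraic_on a b h" "algebraic_degree a b h \<le> d\<^sub>2"
  shows "algebraic_on a b (\<lambda>x. g x - h x)"
    and "algebraic_degree a b (\<lambda>x. g x - h x) \<le> \<eta> d\<^sub>1 d\<^sub>2"
proof -
  have "algebraic_on a b (\<lambda>x. g x + - h x) \<and>
        algebraic_degree a b (\<lambda>x. g x + - h x) \<le> \<eta> d\<^sub>1 d\<^sub>2"
    using assms algebraic_uminus[OF assms(4)] unfolding sum_degree_bound_def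
    by (meson order_trans)
  then show "algebraic_on a b (\<lambda>x. g x - h x)"
    "algebraic_degree a b (\<lambda>x. g x - h x) \<le> \<eta> d\<^sub>1 d\<^sub>2" by simp_all
qed

text \<open>\<open>R\<close> is the root set of the lowest nonzero coefficient \<open>c k\<close>.
  After \<open>f ^ k\<close> is split off, the cofactor \<open>\<phi>\<close> agrees with
  \<open>c k\<close> at the zeros of \<open>f\<close>. Where \<open>c k\<close> has no root, the
  zero sets of \<open>f\<close> and \<open>\<phi>\<close> are thus disjoint, closed, and cover the
  interval. By connectedness one is empty: \<open>f\<close> has no zero there or vanishes
  throughout.\<close>

lemma algebraic_sign_changes:
  assumes "algebraic_on a b f"
  shows "\<exists>R. finite R \<and> card R \<le> algebraic_degree a b f \<and>
             (\<forall>s t. a \<le> s \<and> s < t \<and> t \<le> b \<and> {s..t} \<inter> R = {} \<longrightarrow> 0 \<le> f s * f t)"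
proof -
  obtain m n where deg: "algebraic_degree a b f = m + n" and eqn: "algebraic_equation a b f m n"
    using algebraic_equation_degree[OF assms] .
  obtain c where c: "\<And>i. i \<le> n \<Longrightarrow> degree (c i) \<le> m" "\<exists>i\<le>n. c i \<noteq> 0"
    "\<And>x. x \<in> {a..b} \<Longrightarrow> (\<Sum>i\<le>n. poly (c i) x * f x ^ i) = 0"
    using eqn unfolding algebraic_equation_def by blast
  define k where "k = (LEAST i. c i \<noteq> 0)"
  have k: "c k \<noteq> 0"
    unfolding k_def using LeastI_ex[of "\<lambda>i. c i \<noteq> 0"] c(2) by blast
  have low: "c i = 0" if "i < k" for i
    using not_less_Least[of i "\<lambda>i. c i \<noteq> 0"] that unfolding k_def by blast
  have "k \<le> n"
  proof -
    obtain i where "i \<le> n" "c i \<noteq> 0" using c(2) by blast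
    then show ?thesis using low[of i] by (cases "i < k") auto
  qed
  define \<phi> where "\<phi> x = (\<Sum>i\<in>{k..n}. poly (c i) x * f x ^ (i - k))" for x
  have factor: "f x ^ k * \<phi> x = 0" if "x \<in> {a..b}" for x
  proof -
    have "f x ^ k * \<phi> x = (\<Sum>i\<in>{k..n}. poly (c i) x * f x ^ i)"
      unfolding \<phi>_def sum_distrib_left
      by (rule sum.cong) (auto simp: mult_ac simp flip: power_add)
    also have "\<dots> = (\<Sum>i\<le>n. poly (c i) x * f x ^ i)"
      using low by (intro sum.mono_neutral_left) auto
    finally show ?thesis using c(3)[OF that] by simp
  qed
  \<comment> \<open>At a zero of \<open>f\<close> only the term with exponent
    \<open>i - k = 0\<close> survives, as \<open>0 ^ 0 = 1\<close>.\<close>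
  have \<phi>_zero: "\<phi> x = poly (c k) x" if "f x = 0" for x
  proof -
    have "\<phi> x = (\<Sum>i\<in>{k..n}. if i = k then poly (c k) x else 0)"
      unfolding \<phi>_def using that by (intro sum.cong) auto
    then show ?thesis using \<open>k \<le> n\<close> by simp
  qed
  define R where "R = {x. poly (c k) x = 0}"
  have "finite R" unfolding R_def using k by (rule poly_roots_finite)
  moreover have "card R \<le> algebraic_degree a b f"
    using card_poly_roots_bound[OF k] c(1)[OF \<open>k \<le> n\<close>] deg by (simp add: R_def)
  moreover have "0 \<le> f s * f t"
    if st: "a \<le> s" "s < t" "t \<le> b" "{s..t} \<inter> R = {}" for s t
  proof -
    have sub: "{s..t} \<subseteq> {a..b}" using st by auto
    have contf: "continuous_on {s..t} f"
      using assms sub continuous_on_subset unfolding algebraic_on_def by blast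
    then have cont\<phi>: "continuous_on {s..t} \<phi>"
      unfolding \<phi>_def by (intro continuous_intros)
    define A where "A = {x\<in>{s..t}. f x = 0}"
    define B where "B = {x\<in>{s..t}. \<phi> x = 0}"
    have "closed A" "closed B"
      unfolding A_def B_def
      using continuous_closed_preimage_constant[OF contf, of 0]
        continuous_closed_preimage_constant[OF cont\<phi>, of 0] by auto
    moreover have "{s..t} \<subseteq> A \<union> B"
    proof
      fix z assume z: "z \<in> {s..t}"
      with sub have "f z ^ k * \<phi> z = 0" by (intro factor) blast
      then show "z \<in> A \<union> B" using z by (auto simp: A_def B_def)
    qed
    moreover have "A \<inter> B \<inter> {s..t} = {}"
      using \<phi>_zero st(4) by (auto simp: A_def B_def R_def)
    ultimately have "A \<inter> {s..t} = {} \<or> B \<inter> {s..t} = {}"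
      using connected_closedD[OF connected_Icc, of A B s t] by blast
    then show ?thesis
    proof
      assume "A \<inter> {s..t} = {}"
      then have "0 < f s * f t"
        using st contf by (intro mult_pos_of_nonvanishing) (auto simp: A_def)
      then show ?thesis by simp
    next
      assume "B \<inter> {s..t} = {}"
      moreover have "s \<in> {s..t}" using st by simp
      ultimately have "s \<in> A" using \<open>{s..t} \<subseteq> A \<union> B\<close> by blast
      then show ?thesis by (simp add: A_def)
    qed
  qed
  ultimately show ?thesis by blast
qed

section \<open>Piecewise-algebraic functions: pieces, integrability, complexity\<close>

lemma piecewise_piece:
  assumes "piecewise_representation g r x p" "0 \<le> t" "t < 1"
  obtains q where "q \<le> r" "x q \<le> t" "t < x (Suc q)"
proof -
  \<comment> \<open>The first right endpoint beyond \<open>t\<close>; by minimality the previous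
    one, which is the left endpoint of this piece, is at most \<open>t\<close>.\<close>
  let ?q = "LEAST q. t < x (Suc q)"
  have r: "t < x (Suc r)" using assms by (simp add: piecewise_representation_def)
  then have "t < x (Suc ?q)" "?q \<le> r" by (auto intro: LeastI Least_le)
  moreover have "x ?q \<le> t"
  proof (cases ?q)
    case 0
    then show ?thesis using assms by (simp add: piecewise_representation_def)
  next
    case (Suc j)
    then have "\<not> t < x (Suc j)" by (intro not_less_Least) simp
    with Suc show ?thesis by simp
  qed
  ultimately show ?thesis using that by blast
qed

text \<open>\<open>integral\<close> is 0 by default on non-integrable functions, so the moment
  equations can be combined linearly only once integrability is known. Each piece is continuous up
  to its two endpoints, and the pieces are glued from left to right.\<close>

lemma piecewise_algebraic_integrable:
  assumes "piecewise_representation g r x p" and "continuous_on {0..1} c"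
  shows "(\<lambda>t. c t * g t) integrable_on {0..1}"
proof -
  note rep = assms(1)[unfolded piecewise_representation_def]
  have piece: "(\<lambda>t. c t * g t) integrable_on {x q..x (Suc q)}" if "q \<le> r" for q
  proof (rule integrable_spike_finite[where S = "{x q, x (Suc q)}"])
    have alg: "algebraic_on (x q) (x (Suc q)) (p q)" using rep that by blast
    then have "continuous_on {x q..x (Suc q)} (\<lambda>t. c t * p q t)"
      unfolding algebraic_on_def
      by (intro continuous_on_mult continuous_on_subset[OF assms(2)]) auto
    then show "(\<lambda>t. c t * p q t) integrable_on {x q..x (Suc q)}"
      by (rule integrable_continuous_interval)
    show "c t * g t = c t * p q t" if "t \<in> {x q..x (Suc q)} - {x q, x (Suc q)}" for t
      using rep \<open>q \<le> r\<close> that by force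
  qed simp
  \<comment> \<open>Positivity is carried along because gluing needs the endpoints in order.\<close>
  have "0 < x (Suc q) \<and> (\<lambda>t. c t * g t) integrable_on {0..x (Suc q)}" if "q \<le> r" for q
    using that
  proof (induction q)
    case 0
    then show ?case using rep piece[of 0] by force
  next
    case (Suc q)
    then have "x (Suc q) < x (Suc (Suc q))" using rep by blast
    then show ?case
      using Suc Henstock_Kurzweil_Integration.integrable_combine[OF _ _ _ piece[of "Suc q"]]
      by fastforce
  qed
  from this[of r] show ?thesis using rep by simp
qed

text \<open>The minimum may be attained only by some \<open>g'\<close> that differs from
  \<open>g\<close> at finitely many points, hence the extra witness.\<close>

lemma combinatorial_complexity_representation:
  assumes "piecewise_algebraic g"
  obtains g' r x p where "eq_up_to_finite g g'" "piecewise_representation g' r x p"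
    "combinatorial_complexity g = representation_complexity r x p"
proof -
  have "\<exists>s g' r x p. eq_up_to_finite g g' \<and> piecewise_representation g' r x p \<and>
          s = representation_complexity r x p"
  proof -
    have "eq_up_to_finite g g" by (simp add: eq_up_to_finite_def)
    with assms show ?thesis unfolding piecewise_algebraic_def by blast
  qed
  from LeastI_ex[OF this] show ?thesis
    using that unfolding combinatorial_complexity_def by blast
qed

text \<open>There are \<open>r + 1\<close> pieces of degree at least 1 and \<open>r\<close> interior
  partition points, so the complexity is at least \<open>(r + 1) + r\<close>.\<close>

lemma representation_complexity_bounds:
  assumes "piecewise_representation g r x p" "representation_complexity r x p \<le> d"
  shows "2 * r + 1 \<le> d"
    and "q \<le> r \<Longrightarrow> algebraic_degree (x q) (x (Suc q)) (p q) \<le> d"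
proof -
  let ?D = "\<lambda>q. algebraic_degree (x q) (x (Suc q)) (p q)"
  have "(\<Sum>q\<le>r. 1) \<le> (\<Sum>q\<le>r. ?D q)"
    using assms(1) algebraic_degree_pos unfolding piecewise_representation_def
    by (intro sum_mono) auto
  then show "2 * r + 1 \<le> d" using assms(2) by (simp add: representation_complexity_def)
  show "?D q \<le> d" if "q \<le> r"
    using member_le_sum[of q "{..r}" ?D] that assms(2)
    by (simp add: representation_complexity_def)
qed

section \<open>Sign changes of a difference of two piecewise-algebraic functions\<close>

lemma piecewise_diff_sign_changes:
  assumes "sum_degree_bound \<eta>"
    and g: "piecewise_representation g r x p" "representation_complexity r x p \<le> d"
    and h: "piecewise_representation h s y u" "representation_complexity s y u \<le> d"
  shows "\<exists>T. finite T \<and> card T \<le> 2 * d * (\<eta> d d + 1) \<and>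
             (\<forall>v\<in>{0<..<1}. \<forall>w\<in>{0<..<1}. v < w \<longrightarrow> {v..w} \<inter> T = {} \<longrightarrow>
                0 \<le> (g v - h v) * (g w - h w))"
proof -
  note repg = g(1)[unfolded piecewise_representation_def]
  note reph = h(1)[unfolded piecewise_representation_def]
  \<comment> \<open>Left endpoints only: each cell of the common refinement is indexed by its left
    end, and 1 starts no cell.\<close>
  define S where "S = x ` {..r} \<union> y ` {..s}"
  have "finite S" by (simp add: S_def)
  have "card S \<le> card {..r} + card {..s}"
    unfolding S_def by (meson card_Un_le card_image_le finite_atMost add_mono order_trans)
  \<comment> \<open>From \<open>2 * r + 1 \<le> d\<close> and \<open>2 * s + 1 \<le> d\<close> one
    gets \<open>(r + 1) + (s + 1) \<le> d + 1 \<le> 2 * d\<close>.\<close>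
  then have cardS: "card S \<le> 2 * d"
    using representation_complexity_bounds(1)[OF g] representation_complexity_bounds(1)[OF h]
    by simp
  have inS: "0 \<in> S" using repg by (auto simp: S_def intro!: image_eqI[of _ _ 0])
  \<comment> \<open>\<open>R\<close> catches the sign changes between \<open>a\<close> and the next
    point of \<open>S\<close>. That point stays unnamed: emptiness of
    \<open>{a<..w} \<inter> S\<close>, together with \<open>w < 1\<close>, says that
    \<open>w\<close> comes before it.\<close>
  define good where "good a R \<longleftrightarrow> finite R \<and> card R \<le> \<eta> d d \<and>
      (\<forall>v w. a < v \<and> v < w \<and> w < 1 \<and> {a<..w} \<inter> S = {} \<and> {v..w} \<inter> R = {} \<longrightarrow>
        0 \<le> (g v - h v) * (g w - h w))" for a R
  have "\<exists>R. good a R" if a01: "0 \<le> a" "a < 1" for a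
  proof -
    obtain i where i: "i \<le> r" "x i \<le> a" "a < x (Suc i)" using piecewise_piece[OF g(1) a01] .
    obtain j where j: "j \<le> s" "y j \<le> a" "a < y (Suc j)" using piecewise_piece[OF h(1) a01] .
    \<comment> \<open>Up to \<open>b\<close> both functions stay on a single piece. Since
      \<open>b\<close> is in \<open>S\<close> or equals 1, the conditions on \<open>w\<close> in
      \<open>good\<close> force \<open>w < b\<close>.\<close>
    define b where "b = min (x (Suc i)) (y (Suc j))"
    have b: "a < b" "b \<le> x (Suc i)" "b \<le> y (Suc j)" using i j by (auto simp: b_def)
    have bS: "b \<in> S \<or> b = 1"
    proof -
      have "x (Suc i) \<in> S \<or> x (Suc i) = 1"
        using repg i by (cases "i = r") (auto simp: S_def)
      moreover have "y (Suc j) \<in> S \<or> y (Suc j) = 1"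
        using reph j by (cases "j = s") (auto simp: S_def)
      ultimately show ?thesis by (auto simp: b_def min_def)
    qed
    have algp: "algebraic_on (x i) (x (Suc i)) (p i)" using repg i by blast
    have algu: "algebraic_on (y j) (y (Suc j)) (u j)" using reph j by blast
    let ?f = "\<lambda>t. p i t - u j t"
    have alg: "algebraic_on a b ?f" "algebraic_degree a b ?f \<le> \<eta> d d"
      using algebraic_diff[OF assms(1), of a b "p i" d "u j" d]
        algebraic_subinterval[OF algp i(2) b(1,2)] algebraic_subinterval[OF algu j(2) b(1,3)]
        representation_complexity_bounds(2)[OF g i(1)]
        representation_complexity_bounds(2)[OF h j(1)]
      by (meson order_trans)+
    obtain R where R: "finite R" "card R \<le> \<eta> d d"
      "\<And>v w. \<lbrakk>a \<le> v; v < w; w \<le> b; {v..w} \<inter> R = {}\<rbrakk> \<Longrightarrow> 0 \<le> ?f v * ?f w"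
      using algebraic_sign_changes[OF alg(1)] alg(2) by (meson order_trans)
    have eq: "g t - h t = ?f t" if "a < t" "t < b" for t
      using repg reph i j b that by force
    have "0 \<le> (g v - h v) * (g w - h w)"
      if vw: "a < v" "v < w" "w < 1" "{a<..w} \<inter> S = {}" "{v..w} \<inter> R = {}" for v w
    proof -
      have "w < b" using bS vw b(1) by (force simp: not_le[symmetric])
      then show ?thesis using R(3)[of v w] vw eq by simp
    qed
    then show ?thesis using R(1,2) unfolding good_def by blast
  qed
  then obtain R where R: "\<And>a. \<lbrakk>0 \<le> a; a < 1\<rbrakk> \<Longrightarrow> good a (R a)" by metis
  have S01: "0 \<le> a \<and> a < 1" if "a \<in> S" for a
  proof -
    have "{x q..x (Suc q)} \<subseteq> {0..1} \<and> x q < x (Suc q)" if "q \<le> r" for q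
      using repg that unfolding algebraic_on_def by blast
    moreover have "{y q..y (Suc q)} \<subseteq> {0..1} \<and> y q < y (Suc q)" if "q \<le> s" for q
      using reph that unfolding algebraic_on_def by blast
    ultimately show ?thesis using that unfolding S_def by force
  qed
  \<comment> \<open>Each point of \<open>S\<close> contributes itself and at most
    \<open>\<eta> d d\<close> further points, whence the factor
    \<open>\<eta> d d + 1\<close>.\<close>
  define T where "T = S \<union> (\<Union>a\<in>S. R a)"
  have "finite T"
    using \<open>finite S\<close> R S01 unfolding T_def good_def by auto
  moreover have "card T \<le> 2 * d * (\<eta> d d + 1)"
  proof -
    have "card (\<Union>a\<in>S. R a) \<le> (\<Sum>a\<in>S. card (R a))"
      using \<open>finite S\<close> by (rule card_UN_le)
    also have "\<dots> \<le> (\<Sum>a\<in>S. \<eta> d d)"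
      using R S01 unfolding good_def by (intro sum_mono) blast
    finally have "card T \<le> card S * (\<eta> d d + 1)"
      using card_Un_le[of S "\<Union>a\<in>S. R a"] by (simp add: T_def)
    also have "\<dots> \<le> 2 * d * (\<eta> d d + 1)" using cardS by (rule mult_le_mono1)
    finally show ?thesis .
  qed
  moreover have "0 \<le> (g v - h v) * (g w - h w)"
    if vw: "v \<in> {0<..<1}" "w \<in> {0<..<1}" "v < w" "{v..w} \<inter> T = {}" for v w
  proof -
    define a where "a = Max {z\<in>S. z \<le> v}"
    have ne: "finite {z\<in>S. z \<le> v}" "{z\<in>S. z \<le> v} \<noteq> {}"
      using \<open>finite S\<close> inS vw(1) by (auto intro: exI[of _ 0])
    then have a: "a \<in> S" "a \<le> v" using Max_in[OF ne] by (auto simp: a_def)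
    have "{a<..w} \<inter> S = {}"
    proof -
      have "z \<le> a" if "z \<in> S" "z \<le> w" for z
      proof -
        have "z \<in> T" using that(1) by (simp add: T_def)
        then have "\<not> (v \<le> z \<and> z \<le> w)" using vw(4) by auto
        then show ?thesis using that ne by (simp add: a_def)
      qed
      then show ?thesis by force
    qed
    \<comment> \<open>\<open>good\<close> needs \<open>a < v\<close> strictly, as the value at a
      partition point is arbitrary.\<close>
    moreover have "a \<noteq> v"
    proof
      assume "a = v"
      then have "v \<in> {v..w} \<inter> T" using a(1) vw(3) by (simp add: T_def)
      with vw(4) show False by simp
    qed
    moreover have "{v..w} \<inter> R a = {}" using a vw(4) by (auto simp: T_def)
    ultimately show ?thesis
      using R[of a] S01[OF a(1)] a vw unfolding good_def by auto
  qed
  ultimately show ?thesis by blast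
qed

section \<open>From equal moments to a vanishing integrand\<close>

lemma integral_poly_mult_eqI:
  fixes f g :: "real \<Rightarrow> real"
  assumes "degree P \<le> k"
    and "\<And>j. j \<le> k \<Longrightarrow> (\<lambda>x. x ^ j * f x) integrable_on A"
    and "\<And>j. j \<le> k \<Longrightarrow> (\<lambda>x. x ^ j * g x) integrable_on A"
    and "\<And>j. j \<le> k \<Longrightarrow> integral A (\<lambda>x. x ^ j * f x) = integral A (\<lambda>x. x ^ j * g x)"
  shows "((\<lambda>x. poly P x * (f x - g x)) has_integral 0) A"
proof -
  have "((\<lambda>x. x ^ j * f x - x ^ j * g x) has_integral 0) A" if "j \<le> k" for j
    using has_integral_diff[OF integrable_integral[OF assms(2)[OF that]]
        integrable_integral[OF assms(3)[OF that]]] assms(4)[OF that] by simp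
  then have "((\<lambda>x. \<Sum>j\<le>degree P. coeff P j * (x ^ j * f x - x ^ j * g x)) has_integral
      (\<Sum>j\<le>degree P. coeff P j * 0)) A"
    using assms(1) by (intro has_integral_sum has_integral_mult_right) auto
  moreover have "poly P x * (f x - g x) =
      (\<Sum>j\<le>degree P. coeff P j * (x ^ j * f x - x ^ j * g x))" for x
    by (simp add: poly_altdef sum_distrib_right right_diff_distrib mult.assoc
        flip: sum_subtractf)
  ultimately show ?thesis by simp
qed

text \<open>On a small closed interval around \<open>t\<close> that avoids \<open>D\<close>,
  \<open>G\<close> is continuous, and nonnegativity squeezes its integral between 0 and the total
  integral 0.\<close>

lemma has_integral_0_nonneg_imp_0:
  fixes G :: "real \<Rightarrow> real"
  assumes "(G has_integral 0) {a..b}" and nonneg: "\<And>x. x \<in> {a..b} \<Longrightarrow> 0 \<le> G x"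
    and "finite D" and cont: "\<And>x. x \<in> {a<..<b} - D \<Longrightarrow> isCont G x"
    and t: "t \<in> {a<..<b} - D"
  shows "G t = 0"
proof -
  have "open ({a<..<b} - D)" using \<open>finite D\<close> by (simp add: finite_imp_closed open_Diff)
  then obtain e where e: "e > 0" "cball t e \<subseteq> {a<..<b} - D"
    using t by (meson open_contains_cball)
  define I where "I = {t - e..t + e}"
  have I: "I \<subseteq> {a<..<b} - D" using e by (simp add: I_def cball_eq_atLeastAtMost)
  have contI: "continuous_on I G"
    using cont I by (auto intro!: continuous_at_imp_continuous_on)
  have "integral I G \<le> integral {a..b} G"
  proof (rule integral_subset_le)
    show "I \<subseteq> {a..b}" using I by force
    show "G integrable_on I" using contI unfolding I_def by (rule integrable_continuous_interval)
  qed (use assms in auto)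
  also have "\<dots> = 0" using assms(1) by (rule integral_unique)
  finally have "integral I G \<le> 0" .
  moreover have nonnegI: "0 \<le> G z" if "z \<in> I" for z
  proof -
    have "z \<in> {a<..<b}" using I that by blast
    then show ?thesis by (intro nonneg) simp
  qed
  then have "0 \<le> integral I G"
    using contI by (intro integral_nonneg) (auto simp: I_def intro: integrable_continuous_interval)
  ultimately have "integral I G = 0" by simp
  then have "\<forall>z\<in>I. G z = 0"
    using integral_eq_0_iff[of "t - e" "t + e" G] contI nonnegI e(1) by (simp add: I_def)
  moreover have "t \<in> I" using e(1) by (simp add: I_def)
  ultimately show ?thesis by blast
qed

theorem theorem2p2:
  fixes \<eta> :: "nat \<Rightarrow> nat \<Rightarrow> nat" and d :: nat and g h :: "real \<Rightarrow> real"
  assumes "sum_degree_bound \<eta>"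
    and "d \<ge> 1"
    and "piecewise_algebraic g" and "combinatorial_complexity g = d"
    and "piecewise_algebraic h" and "combinatorial_complexity h \<le> d"
    and "\<And>j. j \<le> 2 * d * (\<eta> d d + 1) \<Longrightarrow>
           integral {0..1} (\<lambda>x. x ^ j * g x) = integral {0..1} (\<lambda>x. x ^ j * h x)"
  shows "eq_up_to_finite g h"
proof -
  \<comment> \<open>Sign changes are counted for the representatives \<open>g'\<close> and
    \<open>h'\<close> of minimal complexity, while the moments are those of \<open>g\<close> and
    \<open>h\<close>.\<close>
  obtain g' r x p where g': "eq_up_to_finite g g'" "piecewise_representation g' r x p"
    "combinatorial_complexity g = representation_complexity r x p"
    using combinatorial_complexity_representation[OF assms(3)] .
  obtain h' s y u where h': "eq_up_to_finite h h'" "piecewise_representation h' s y u"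
    "combinatorial_complexity h = representation_complexity s y u"
    using combinatorial_complexity_representation[OF assms(5)] .
  have "representation_complexity r x p \<le> d" "representation_complexity s y u \<le> d"
    using assms(4,6) g'(3) h'(3) by simp_all
  then obtain T where T: "finite T" "card T \<le> 2 * d * (\<eta> d d + 1)"
    "\<And>v w. \<lbrakk>v \<in> {0<..<1}; w \<in> {0<..<1}; v < w; {v..w} \<inter> T = {}\<rbrakk> \<Longrightarrow>
       0 \<le> (g' v - h' v) * (g' w - h' w)"
    using piecewise_diff_sign_changes[OF assms(1) g'(2) _ h'(2)] by meson
  obtain P where P: "degree P \<le> card T" "{x. poly P x = 0} \<subseteq> T"
    "\<And>x. x \<in> {0<..<1} - T \<Longrightarrow> 0 \<le> poly P x * (g' x - h' x)"
    using exists_sign_matching_poly[OF T(1), of "{0<..<1}" "\<lambda>x. g' x - h' x"] T(3) by meson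
  have int: "(\<lambda>x. x ^ j * f x) integrable_on {0..1}" if "piecewise_algebraic f" for f j
    using that unfolding piecewise_algebraic_def
    by (auto intro!: piecewise_algebraic_integrable continuous_intros)
  \<comment> \<open>The degree of \<open>P\<close> is at most \<open>card T\<close>, which is within
    the range of the given moments.\<close>
  have int0: "((\<lambda>x. poly P x * (g x - h x)) has_integral 0) {0..1}"
    using assms(7) P(1) T(2) int assms(3,5)
    by (intro integral_poly_mult_eqI[where k = "2 * d * (\<eta> d d + 1)"]) auto
  define D where "D = {t\<in>{0..1}. g t \<noteq> g' t} \<union> {t\<in>{0..1}. h t \<noteq> h' t} \<union> T \<union> {0, 1} \<union>
    x ` {..r} \<union> y ` {..s}"
  have "finite D" using g'(1) h'(1) T(1) by (auto simp: D_def eq_up_to_finite_def)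
  \<comment> \<open>On the finite set \<open>D\<close> the sign of the product is not controlled;
    the value 0 there makes \<open>G\<close> nonnegative on all of \<open>{0..1}\<close> without
    changing the integral.\<close>
  define G where "G t = (if t \<in> D then 0 else poly P t * (g' t - h' t))" for t
  have intG: "(G has_integral 0) {0..1}"
    by (rule has_integral_spike_finite[OF \<open>finite D\<close> _ int0]) (auto simp: G_def D_def)
  have nonneg: "0 \<le> G t" if "t \<in> {0..1}" for t
    using that P(3)[of t] by (auto simp: G_def D_def)
  have cont: "isCont G t" if t: "t \<in> {0<..<1} - D" for t
  proof -
    obtain i where i: "i \<le> r" "x i \<le> t" "t < x (Suc i)"
      using piecewise_piece[OF g'(2), of t] t by auto
    obtain j where j: "j \<le> s" "y j \<le> t" "t < y (Suc j)"
      using piecewise_piece[OF h'(2), of t] t by auto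
    \<comment> \<open>Removing \<open>D\<close> leaves an open neighbourhood of \<open>t\<close> on
      which \<open>G\<close> is given by one continuous formula.\<close>
    define U where "U = {x i<..<x (Suc i)} \<inter> {y j<..<y (Suc j)} - D"
    have "open U" using \<open>finite D\<close> by (simp add: U_def finite_imp_closed open_Diff open_Int)
    have "x i \<noteq> t" "y j \<noteq> t" using t i j by (auto simp: D_def)
    then have "t \<in> U" using t i j by (auto simp: U_def)
    have eq: "G z = poly P z * (p i z - u j z)" if "z \<in> U" for z
      using that g'(2) h'(2) i(1) j(1) by (auto simp: U_def G_def piecewise_representation_def)
    have "continuous_on {x i..x (Suc i)} (p i)" "continuous_on {y j..y (Suc j)} (u j)"
      using g'(2) h'(2) i(1) j(1) unfolding piecewise_representation_def algebraic_on_def by auto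
    then have "continuous_on U (\<lambda>z. poly P z * (p i z - u j z))"
      by (auto intro!: continuous_intros elim!: continuous_on_subset simp: U_def)
    then have "continuous_on U G" using eq by (simp cong: continuous_on_cong)
    then show ?thesis using \<open>open U\<close> \<open>t \<in> U\<close> by (simp add: continuous_on_eq_continuous_at)
  qed
  have "g t = h t" if "t \<in> {0..1} - D" for t
  proof -
    have t: "t \<in> {0<..<1} - D" using that by (auto simp: D_def)
    have "G t = 0" using has_integral_0_nonneg_imp_0[OF intG nonneg \<open>finite D\<close> cont t] .
    \<comment> \<open>The roots of \<open>P\<close> lie in \<open>T\<close>, hence in
      \<open>D\<close>.\<close>
    moreover have "poly P t \<noteq> 0" using P(2) t by (auto simp: D_def)
    ultimately have "g' t = h' t" using t by (simp add: G_def)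
    then show ?thesis using t by (auto simp: D_def)
  qed
  then have "{t\<in>{0..1}. g t \<noteq> h t} \<subseteq> D" by auto
  then show ?thesis
    using \<open>finite D\<close> unfolding eq_up_to_finite_def by (rule finite_subset)
qed

end
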